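(* Let $n\ge3$, let $\rho>1$ satisfy $\frac{\rho}{\rho-1}<n-1$, $p=n(\rho-1)$, $q=(n-1)(\rho-1)$. Let $h:\mathbb{R}\to\mathbb{R}$ satisfy $h(0)=0$ and $|h(a)-h(b)|\le\eta|a-b|(|a|^{\rho-1}+|b|^{\rho-1})$ for all $a,b\in\mathbb{R}$, with a constant $\eta>0$. Let $V\in L^{(n-1,\infty)}(\partial\mathbb{R}^n_+)$ and $u_0\in L^{(p,\infty)}(\mathbb{R}^n_+)$ satisfy the smallness conditions $\|V\|_{L^{(n-1,\infty)}(\partial\mathbb{R}^n_+)}<\frac1{\delta_1}$ and $\|u_0\|_{L^{(p,\infty)}(\mathbb{R}^n_+)}\le\frac{\varepsilon}{\delta_2}$ (constants as in the context), and let $u\in BC((0,\infty);\mathcal{X}_{p,q})$ be the corresponding mild solution. Let $\mathcal{U}\subset\mathbb{R}^n_+$ be a set of positive measure and let $\mathcal{A}$ be a subset of $\mathcal{O}_{x_n}$. (A) Suppose $h(a)\ge0$ when $a\ge0$ (resp. $h(a)\le0$ when $a\le0$). If $u_0\ge0$ (resp. $u_0\le0$) a.e. in $\mathbb{R}^n_+$, $u_0>0$ (resp. $u_0<0$) in $\mathcal{U}$, and $V\ge0$ in $\partial\mathbb{R}^n_+$, then $u$ is positive (resp. negative) in $\mathbb{R}^n_+\times(0,\infty)$. (B) Suppose $h(a)=-h(-a)$ for all $a\in\mathbb{R}$ and $V$ is symmetric under the action of $\mathcal{A}|_{\partial\mathbb{R}^n_+}$. If $u_0$ is symmetric (resp.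 antisymmetric) under $\mathcal{A}$, then for all $t>0$ the solution $u(\cdot,t)$ is symmetric (resp. antisymmetric) under $\mathcal{A}$.
   Context: $\mathbb{R}^n_+=\{x=(x',x_n): x'\in\mathbb{R}^{n-1},\ x_n>0\}$; $\partial\mathbb{R}^n_+$ is identified with $\mathbb{R}^{n-1}$ with Lebesgue measure $dx'$, and $y'\in\partial\mathbb{R}^n_+$ with $(y',0)$. Weak $L^r$ spaces: for measurable $f$ on $\Omega$, $f^*(t)=\inf\{s>0: |\{x\in\Omega:|f(x)|>s\}|\le t\}$, $f^{**}(t)=\frac1t\int_0^tf^*(s)\,ds$; for $1<r<\infty$, $L^{(r,\infty)}(\Omega)$ is the Banach space of $f$ with $\|f\|_{L^{(r,\infty)}(\Omega)}=\sup_{t>0}t^{1/r}f^{**}(t)<\infty$. Kernel: for $x,y\in\overline{\mathbb{R}^n_+}$, $t>0$, with $y^*=(y',-y_n)$, $G(x,y,t)=(4\pi t)^{-n/2}\left[e^{-|x-y|^2/(4t)}+e^{-|x-y^*|^2/(4t)}\right]$. Space $\mathcal{X}_{p,q}$: functions $f:\overline{\mathbb{R}^n_+}\to\mathbb{R}$ with $f|_{\mathbb{R}^n_+}$ and $f|_{\partial\mathbb{R}^n_+}$ Lebesgue measurable (in dimension $n$, resp. $n-1$), modulo equality a.e. in $\mathbb{R}^n_+$ together with equality a.e. in $\partial\mathbb{R}^n_+$, with $\|f\|_{\mathcal{X}_{p,q}}=\|f\|_{L^{(p,\infty)}(\mathbb{R}^n_+)}+\|f|_{\partial\mathbb{R}^n_+}\|_{L^{(q,\infty)}(\partial\mathbb{R}^n_+)}<\infty$.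 $E=BC((0,\infty);\mathcal{X}_{p,q})$ is the Banach space of bounded continuous functions $(0,\infty)\to\mathcal{X}_{p,q}$ with norm $\|u\|_E=\sup_{t>0}\|u(\cdot,t)\|_{\mathcal{X}_{p,q}}$. Mild solution: let $$\Phi(u)(x,t)=\int_{\mathbb{R}^n_+}G(x,y,t)u_0(y)\,dy+\int_0^t\int_{\partial\mathbb{R}^n_+}G(x,y',t-s)\,[h(u)+Vu](y',s)\,dy'\,ds,$$ considered for $x\in\mathbb{R}^n_+$ and $x\in\partial\mathbb{R}^n_+$, where $u(y',s)$ is the boundary component of $u(\cdot,s)$. Fix constants $\delta_1,\delta_2>0$ depending only on $n,\rho,\eta$, and $\varepsilon=\varepsilon(\gamma)>0$ depending only on $n,\rho,\eta$ and $\gamma=\delta_1\|V\|_{L^{(n-1,\infty)}(\partial\mathbb{R}^n_+)}$, such that whenever $\|V\|_{L^{(n-1,\infty)}(\partial\mathbb{R}^n_+)}<1/\delta_1$ and $\|u_0\|_{L^{(p,\infty)}(\mathbb{R}^n_+)}\le\varepsilon/\delta_2$, $\Phi$ maps the closed ball $\{u\in E:\|u\|_E\le\frac{2\varepsilon}{1-\gamma}\}$ into itself and is a strict contraction there; such constants exist. The mild solution corresponding to $(u_0,V,h)$ is the unique fixed point of $\Phi$ in this ball. Symmetry: $\mathcal{O}_{x_n}$ is the set of all rotations around the axis $\overrightarrow{Ox_n}$, i.e. maps $T(x',x_n)=(Rx',x_n)$ with $R$ an orthogonal transformation of $\mathbb{R}^{n-1}$; $\mathcal{A}|_{\partial\mathbb{R}^n_+}$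 is the set of restrictions to $\partial\mathbb{R}^n_+$ of the elements of $\mathcal{A}$. A function $f$ is symmetric under $\mathcal{A}$ if $f(x)=f(T(x))$ for all $T\in\mathcal{A}$, and antisymmetric under $\mathcal{A}$ if $f(x)=-f(T(x))$ for all $T\in\mathcal{A}$. Identities and inequalities between elements of function spaces are understood almost everywhere (for $u(\cdot,t)$: for every $t>0$, a.e. in $\mathbb{R}^n_+$, and for symmetries also a.e. on $\partial\mathbb{R}^n_+$). *)

theory Defs
  imports "HOL-Analysis.Analysis"
begin

text \<open>
  With \<open>n = CARD('m) + 1\<close>, the space \<open>R^n\<close> is rendered as \<open>(real ^ 'm) \<times> real\<close>, a Euclidean space
  whose points are literally the pairs \<open>(x', x_n)\<close>, and the boundary of the half-space as
  \<open>real ^ 'm\<close>. Functions on a subset are functions on the whole type of which only the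
  values on that subset matter; elements of function spaces are represented by functions, and
  equality in those spaces is equality almost everywhere.
\<close>

type_synonym 'm bpt = "real ^ 'm"
type_synonym 'm pt = "(real ^ 'm) \<times> real"

definition half_space :: "('m::finite) pt set" where
  "half_space = {x. snd x > 0}"

definition bdry_trace :: "(('m::finite) pt \<Rightarrow> real) \<Rightarrow> 'm bpt \<Rightarrow> real" where
  "bdry_trace f = (\<lambda>x'. f (x', 0))"


subsection \<open>Weak Lebesgue spaces\<close>

definition rearr :: "'a measure \<Rightarrow> ('a \<Rightarrow> real) \<Rightarrow> real \<Rightarrow> ennreal" where
  "rearr M f t =
     Inf {ennreal s | s. s > 0 \<and> emeasure M {x \<in> space M. \<bar>f x\<bar> > s} \<le> ennreal t}"

definition rearr_mean :: "'a measure \<Rightarrow> ('a \<Rightarrow> real) \<Rightarrow> real \<Rightarrow> ennreal" where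
  "rearr_mean M f t = (\<integral>\<^sup>+ s \<in> {0<..<t}. rearr M f s \<partial>lborel) / ennreal t"

definition weak_norm :: "real \<Rightarrow> 'a measure \<Rightarrow> ('a \<Rightarrow> real) \<Rightarrow> ennreal" where
  "weak_norm r M f = (SUP t \<in> {0<..}. ennreal (t powr (1 / r)) * rearr_mean M f t)"

definition weak_L :: "real \<Rightarrow> 'a measure \<Rightarrow> ('a \<Rightarrow> real) set" where
  "weak_L r M = {f \<in> borel_measurable M. weak_norm r M f < \<infinity>}"


subsection \<open>The spaces \<open>\<X>_{p,q}\<close> and \<open>BC((0,\<infinity>); \<X>_{p,q})\<close>\<close>

definition X_norm :: "real \<Rightarrow> real \<Rightarrow> (('m::finite) pt \<Rightarrow> real) \<Rightarrow> ennreal" where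
  "X_norm p q f = weak_norm p (lebesgue_on half_space) f + weak_norm q lebesgue (bdry_trace f)"

definition X_space :: "real \<Rightarrow> real \<Rightarrow> (('m::finite) pt \<Rightarrow> real) set" where
  "X_space p q =
     {f. f \<in> borel_measurable (lebesgue_on half_space) \<and> bdry_trace f \<in> borel_measurable lebesgue
         \<and> X_norm p q f < \<infinity>}"

definition X_eq :: "(('m::finite) pt \<Rightarrow> real) \<Rightarrow> ('m pt \<Rightarrow> real) \<Rightarrow> bool" where
  "X_eq f g \<longleftrightarrow> (AE x in lebesgue_on half_space. f x = g x)
              \<and> (AE x' in lebesgue. bdry_trace f x' = bdry_trace g x')"

text \<open>The time variable is the first argument; only its positive values matter.\<close>

definition E_norm :: "real \<Rightarrow> real \<Rightarrow> (real \<Rightarrow> ('m::finite) pt \<Rightarrow> real) \<Rightarrow> ennreal" where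
  "E_norm p q u = (SUP t \<in> {0<..}. X_norm p q (u t))"

definition E_space :: "real \<Rightarrow> real \<Rightarrow> (real \<Rightarrow> ('m::finite) pt \<Rightarrow> real) set" where
  "E_space p q =
     {u. (\<forall>t>0. u t \<in> X_space p q)
       \<and> (\<forall>t>0. ((\<lambda>s. X_norm p q (\<lambda>x. u s x - u t x)) \<longlongrightarrow> 0) (at t within {0<..}))
       \<and> E_norm p q u < \<infinity>}"

definition E_ball :: "real \<Rightarrow> real \<Rightarrow> real \<Rightarrow> (real \<Rightarrow> ('m::finite) pt \<Rightarrow> real) set" where
  "E_ball p q R = {u \<in> E_space p q. E_norm p q u \<le> ennreal R}"


subsection \<open>Mild solutions\<close>

definition G :: "('m::finite) pt \<Rightarrow> 'm pt \<Rightarrow> real \<Rightarrow> real" where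
  "G x y t = (4 * pi * t) powr (- (real (CARD('m) + 1) / 2)) *
     (exp (- (norm (x - y))\<^sup>2 / (4 * t)) + exp (- (norm (x - (fst y, - snd y)))\<^sup>2 / (4 * t)))"

text \<open>
  The double integral is an iterated one because \<open>u s\<close> is only determined up to null sets for
  each \<open>s\<close> separately, so that joint measurability in \<open>(y', s)\<close> cannot be expected.
\<close>

definition \<Phi> ::
  "(('m::finite) pt \<Rightarrow> real) \<Rightarrow> ('m bpt \<Rightarrow> real) \<Rightarrow> (real \<Rightarrow> real)
    \<Rightarrow> (real \<Rightarrow> 'm pt \<Rightarrow> real) \<Rightarrow> real \<Rightarrow> 'm pt \<Rightarrow> real" where
  "\<Phi> u0 V h u t x =
     (LINT y | lebesgue_on half_space. G x y t * u0 y)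
   + (LINT s | lebesgue_on {0<..<t}. LINT y' | lebesgue.
        G x (y', 0) (t - s) * (h (bdry_trace (u s) y') + V y' * bdry_trace (u s) y'))"

definition growth_cond :: "real \<Rightarrow> real \<Rightarrow> (real \<Rightarrow> real) \<Rightarrow> bool" where
  "growth_cond \<rho> \<eta> h \<longleftrightarrow> h 0 = 0 \<and>
     (\<forall>a b. \<bar>h a - h b\<bar> \<le> \<eta> * \<bar>a - b\<bar> * (\<bar>a\<bar> powr (\<rho> - 1) + \<bar>b\<bar> powr (\<rho> - 1)))"

definition gamma_of :: "real \<Rightarrow> (('m::finite) bpt \<Rightarrow> real) \<Rightarrow> real" where
  "gamma_of \<delta>1 V = \<delta>1 * enn2real (weak_norm (real CARD('m)) lebesgue V)"

definition small_data ::
  "real \<Rightarrow> real \<Rightarrow> real \<Rightarrow> (real \<Rightarrow> real) \<Rightarrow> (('m::finite) pt \<Rightarrow> real) \<Rightarrow> ('m bpt \<Rightarrow> real) \<Rightarrow> bool" where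
  "small_data p \<delta>1 \<delta>2 \<epsilon> u0 V \<longleftrightarrow>
     weak_norm (real CARD('m)) lebesgue V < ennreal (1 / \<delta>1) \<and>
     weak_norm p (lebesgue_on half_space) u0 \<le> ennreal (\<epsilon> (gamma_of \<delta>1 V) / \<delta>2)"

definition solution_ball ::
  "real \<Rightarrow> real \<Rightarrow> real \<Rightarrow> (real \<Rightarrow> real) \<Rightarrow> (('m::finite) bpt \<Rightarrow> real)
    \<Rightarrow> (real \<Rightarrow> 'm pt \<Rightarrow> real) set" where
  "solution_ball p q \<delta>1 \<epsilon> V = E_ball p q (2 * \<epsilon> (gamma_of \<delta>1 V) / (1 - gamma_of \<delta>1 V))"

definition strict_contraction_on ::
  "real \<Rightarrow> real \<Rightarrow> (real \<Rightarrow> ('m::finite) pt \<Rightarrow> real) set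
    \<Rightarrow> ((real \<Rightarrow> 'm pt \<Rightarrow> real) \<Rightarrow> (real \<Rightarrow> 'm pt \<Rightarrow> real)) \<Rightarrow> bool" where
  "strict_contraction_on p q B F \<longleftrightarrow>
     (\<exists>K. 0 \<le> K \<and> K < 1 \<and>
       (\<forall>u\<in>B. \<forall>v\<in>B. E_norm p q (\<lambda>t x. F u t x - F v t x)
                        \<le> ennreal K * E_norm p q (\<lambda>t x. u t x - v t x)))"

text \<open>
  The constants of the well-posedness theory. They serve all data \<open>h, V, u0\<close> at once, i.e. they
  depend on \<open>n, \<rho>, \<eta>\<close> only (and \<open>\<epsilon>\<close> moreover on \<open>\<gamma>\<close>); the dimension enters through the
  type argument.
\<close>

definition admissible_constants ::
  "('m::finite) itself \<Rightarrow> real \<Rightarrow> real \<Rightarrow> real \<Rightarrow> real \<Rightarrow> real \<Rightarrow> real \<Rightarrow> (real \<Rightarrow> real) \<Rightarrow> bool" where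
  "admissible_constants TYPE('m) \<rho> \<eta> p q \<delta>1 \<delta>2 \<epsilon> \<longleftrightarrow>
     \<delta>1 > 0 \<and> \<delta>2 > 0 \<and> (\<forall>\<gamma>. 0 \<le> \<gamma> \<and> \<gamma> < 1 \<longrightarrow> \<epsilon> \<gamma> > 0) \<and>
     (\<forall>h (V :: 'm bpt \<Rightarrow> real) (u0 :: 'm pt \<Rightarrow> real).
        growth_cond \<rho> \<eta> h \<and> V \<in> weak_L (real CARD('m)) lebesgue \<and>
        u0 \<in> weak_L p (lebesgue_on half_space) \<and> small_data p \<delta>1 \<delta>2 \<epsilon> u0 V \<longrightarrow>
        \<Phi> u0 V h ` solution_ball p q \<delta>1 \<epsilon> V \<subseteq> solution_ball p q \<delta>1 \<epsilon> V \<and>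
        strict_contraction_on p q (solution_ball p q \<delta>1 \<epsilon> V) (\<Phi> u0 V h))"

text \<open>
  For admissible constants and small data the fixed point is unique up to equality in \<open>\<X>_{p,q}\<close>
  for every \<open>t > 0\<close>, so uniqueness need not be part of the predicate.
\<close>

definition mild_solution ::
  "real \<Rightarrow> real \<Rightarrow> real \<Rightarrow> (real \<Rightarrow> real) \<Rightarrow> (('m::finite) pt \<Rightarrow> real) \<Rightarrow> ('m bpt \<Rightarrow> real)
    \<Rightarrow> (real \<Rightarrow> real) \<Rightarrow> (real \<Rightarrow> 'm pt \<Rightarrow> real) \<Rightarrow> bool" where
  "mild_solution p q \<delta>1 \<epsilon> u0 V h u \<longleftrightarrow>
     u \<in> solution_ball p q \<delta>1 \<epsilon> V \<and> (\<forall>t>0. X_eq (\<Phi> u0 V h u t) (u t))"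


subsection \<open>Symmetries\<close>

definition axis_rotations :: "(('m::finite) pt \<Rightarrow> 'm pt) set" where
  "axis_rotations = {\<lambda>x. (R (fst x), snd x) | R. orthogonal_transformation R}"

definition boundary_restrictions :: "(('m::finite) pt \<Rightarrow> 'm pt) set \<Rightarrow> ('m bpt \<Rightarrow> 'm bpt) set" where
  "boundary_restrictions A = (\<lambda>T x'. fst (T (x', 0))) ` A"

definition symmetric_under :: "'a measure \<Rightarrow> ('a \<Rightarrow> 'a) set \<Rightarrow> ('a \<Rightarrow> real) \<Rightarrow> bool" where
  "symmetric_under M A f \<longleftrightarrow> (\<forall>T\<in>A. AE x in M. f x = f (T x))"

definition antisymmetric_under :: "'a measure \<Rightarrow> ('a \<Rightarrow> 'a) set \<Rightarrow> ('a \<Rightarrow> real) \<Rightarrow> bool" where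
  "antisymmetric_under M A f \<longleftrightarrow> (\<forall>T\<in>A. AE x in M. f x = - f (T x))"

end

theory Submission
  imports Defs "HOL-Probability.Distributions"
begin

text \<open>
  The Picard iterates \<open>\<Phi>\<^sup>k(0)\<close> converge geometrically to \<open>u\<close> in \<open>E\<close>, hence, by the weak type
  Chebyshev inequality and Borel--Cantelli, almost everywhere for each \<open>t\<close>, in the half-space and on
  its boundary. Since \<open>0\<close> has every sign and every symmetry, and \<open>\<Phi>\<close> preserves signs (the kernel
  is positive) and symmetries (the kernel and Lebesgue measure are rotation invariant), \<open>u\<close>
  inherits them. Strict positivity then follows from \<open>u = \<Phi>(u) \<ge> \<integral> G u\<^sub>0 > 0\<close>.
\<close>

section \<open>Invariance of Lebesgue measure and its integral under orthogonal maps\<close>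

lemma nn_integral_lborel_shift:
  fixes f :: "'a::euclidean_space \<Rightarrow> ennreal"
  assumes [measurable]: "f \<in> borel_measurable borel"
  shows "(\<integral>\<^sup>+x. f (a + x) \<partial>lborel) = (\<integral>\<^sup>+x. f x \<partial>lborel)"
proof -
  have "(\<integral>\<^sup>+x. f x \<partial>lborel) = (\<integral>\<^sup>+x. f x \<partial>distr lborel borel ((+) a))"
    by (simp add: lborel_distr_plus)
  also have "\<dots> = (\<integral>\<^sup>+x. f (a + x) \<partial>lborel)"
    by (rule nn_integral_distr) auto
  finally show ?thesis ..
qed

lemma orthogonal_transformation_borel_measurable:
  fixes T :: "'a::euclidean_space \<Rightarrow> 'a"
  assumes "orthogonal_transformation T"
  shows "T \<in> borel_measurable borel"
  using orthogonal_transformation_linear[OF assms]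
  by (intro borel_measurable_continuous_onI linear_continuous_on)
    (simp add: linear_conv_bounded_linear[symmetric])

text \<open>Uniqueness of Haar measure in miniature: evaluating
  \<open>\<integral>\<integral> 1\<^sub>A(T z + y) 1\<^sub>B(y) dz dy\<close> for the unit ball \<open>B\<close> in both orders gives
  \<open>|T\<inverse> A| |B| = |A| |B|\<close>.\<close>

lemma lborel_distr_orthogonal:
  fixes T :: "'a::euclidean_space \<Rightarrow> 'a"
  assumes T: "orthogonal_transformation T"
  shows "distr lborel borel T = lborel"
proof (rule measure_eqI)
  fix A :: "'a set" assume "A \<in> sets (distr lborel borel T)"
  then have A[measurable]: "A \<in> sets borel" by simp
  note mT[measurable] = orthogonal_transformation_borel_measurable[OF T]
  have lin: "linear T" and bij: "bij T"
    using T by (auto simp: orthogonal_transformation_linear orthogonal_transformation_bij)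
  let ?B = "ball 0 1 :: 'a set"
  have [measurable]: "?B \<in> sets borel" by simp
  have eA: "emeasure (distr lborel borel T) A = (\<integral>\<^sup>+z. indicator A (T z) \<partial>lborel)"
  proof -
    have "(\<integral>\<^sup>+z. indicator A (T z) \<partial>lborel) = (\<integral>\<^sup>+z. indicator A z \<partial>distr lborel borel T)"
      by (rule nn_integral_distr[symmetric]) auto
    then show ?thesis by simp
  qed
  \<comment> \<open>Writing \<open>y = T w\<close> turns the outer shift by \<open>y\<close> into an
    inner shift by \<open>w\<close>, which \<open>lborel\<close> ignores.\<close>
  have shift: "(\<integral>\<^sup>+z. indicator A (T z + y) \<partial>lborel) = emeasure (distr lborel borel T) A" for y
  proof -
    obtain w where w: "y = T w" using bij by (metis bij_pointE)
    have "(\<integral>\<^sup>+z. indicator A (T z + y) \<partial>lborel) = (\<integral>\<^sup>+z. indicator A (T (w + z)) \<partial>lborel)"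
      by (simp add: w linear_add[OF lin] add.commute)
    also have "\<dots> = (\<integral>\<^sup>+z. indicator A (T z) \<partial>lborel)"
      by (rule nn_integral_lborel_shift) measurable
    finally show ?thesis using eA by simp
  qed
  have ball: "(\<integral>\<^sup>+z. indicator ?B (y - T z) \<partial>lborel) = emeasure lborel ?B" for y
  proof -
    obtain w where w: "y = T w" using bij by (metis bij_pointE)
    have "(\<integral>\<^sup>+z. indicator ?B (y - T z) \<partial>lborel) = (\<integral>\<^sup>+z. indicator (ball w 1) z \<partial>lborel)"
      using orthogonal_transformation_norm[OF T]
      by (intro nn_integral_cong)
        (simp add: w flip: linear_diff[OF lin], simp add: indicator_def dist_norm)
    also have "\<dots> = emeasure lborel ?B" by (simp add: emeasure_ball)
    finally show ?thesis .
  qed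
  have "emeasure (distr lborel borel T) A * emeasure lborel ?B =
      (\<integral>\<^sup>+y. (\<integral>\<^sup>+z. indicator A (T z + y) * indicator ?B y \<partial>lborel) \<partial>lborel)"
    by (simp add: nn_integral_multc shift nn_integral_cmult_indicator)
  also have "\<dots> = (\<integral>\<^sup>+z. (\<integral>\<^sup>+y. indicator A (T z + y) * indicator ?B y \<partial>lborel) \<partial>lborel)"
    by (rule lborel_pair.Fubini') measurable
  \<comment> \<open>For fixed \<open>z\<close>, translating \<open>y\<close> by \<open>T z\<close>
    moves the dependence on \<open>z\<close> from \<open>A\<close> to the ball, whose shape
    \<open>T\<close> respects.\<close>
  also have "\<dots> = (\<integral>\<^sup>+z. (\<integral>\<^sup>+y. indicator A y * indicator ?B (y - T z) \<partial>lborel) \<partial>lborel)"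
  proof (rule nn_integral_cong)
    fix z
    show "(\<integral>\<^sup>+y. indicator A (T z + y) * indicator ?B y \<partial>lborel) =
        (\<integral>\<^sup>+y. indicator A y * indicator ?B (y - T z) \<partial>lborel)"
      using nn_integral_lborel_shift[of "\<lambda>y. indicator A y * indicator ?B (y - T z)" "T z"]
      by simp
  qed
  also have "\<dots> = (\<integral>\<^sup>+y. (\<integral>\<^sup>+z. indicator A y * indicator ?B (y - T z) \<partial>lborel) \<partial>lborel)"
    by (rule lborel_pair.Fubini') measurable
  also have "\<dots> = emeasure lborel A * emeasure lborel ?B"
    by (simp add: nn_integral_cmult ball nn_integral_multc)
  finally have *: "emeasure (distr lborel borel T) A * emeasure lborel ?B
      = emeasure lborel A * emeasure lborel ?B" .
  \<comment> \<open>A ball has positive finite measure, so this factor cancels in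
    \<open>ennreal\<close>.\<close>
  have "emeasure lborel ?B \<noteq> 0" "emeasure lborel ?B \<noteq> top"
    by (auto simp: emeasure_ball ennreal_eq_0_iff not_le)
  with * show "emeasure (distr lborel borel T) A = emeasure lborel A"
    by (metis mult_divide_eq_ennreal)
qed simp

text \<open>The image of \<open>lebesgue\<close> under \<open>T\<close> is \<open>lborel\<close> on
  Borel sets, so preimages of Borel null sets are null. Hence \<open>T\<close> is measurable for the
  completed \<sigma>-algebras as well, and the equality of measures passes to the
  completion.\<close>

lemma lebesgue_distr_orthogonal:
  fixes T :: "'a::euclidean_space \<Rightarrow> 'a"
  assumes T: "orthogonal_transformation T"
  shows "T \<in> lebesgue \<rightarrow>\<^sub>M lebesgue" and "distr lebesgue lebesgue T = lebesgue"
proof -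
  have mT: "T \<in> lborel \<rightarrow>\<^sub>M lborel"
    using orthogonal_transformation_borel_measurable[OF T] by simp
  then have mT': "T \<in> lebesgue \<rightarrow>\<^sub>M lborel" by (rule measurable_completion)
  have d: "distr lebesgue lborel T = lborel"
    using lborel_distr_orthogonal[OF T] distr_completion[OF mT]
      distr_cong[of lborel lborel lborel borel T T] by simp
  show "T \<in> lebesgue \<rightarrow>\<^sub>M lebesgue"
    by (rule completion.measurable_completion2[OF mT']) (simp add: d)
  show "distr lebesgue lebesgue T = lebesgue"
    using completion.completion_distr_eq[OF mT'] d by simp
qed

lemma orthogonal_transformation_inverse:
  fixes T :: "'a::euclidean_space \<Rightarrow> 'a"
  assumes "orthogonal_transformation T"
  obtains S where "orthogonal_transformation S" "\<And>x. S (T x) = x" "\<And>x. T (S x) = x"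
  by (metis assms bij_inv_eq_iff orthogonal_transformation_bij orthogonal_transformation_inv)

text \<open>No measurability is needed because \<open>T\<close> is invertible and the integral of a nonintegrable
  function is \<open>0\<close>.\<close>

lemma integral_lebesgue_orthogonal:
  fixes T :: "'a::euclidean_space \<Rightarrow> 'a" and f :: "'a \<Rightarrow> real"
  assumes T: "orthogonal_transformation T"
  shows "(LINT x|lebesgue. f (T x)) = (LINT x|lebesgue. f x)"
proof -
  obtain S where S: "orthogonal_transformation S" "\<And>x. S (T x) = x" "\<And>x. T (S x) = x"
    using orthogonal_transformation_inverse[OF T] by blast
  have *: "integrable lebesgue (\<lambda>x. g (R x))"
    if "integrable lebesgue g" "orthogonal_transformation R" for g :: "'a \<Rightarrow> real" and R :: "'a \<Rightarrow> 'a"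
    using integrable_distr[of R lebesgue lebesgue g] lebesgue_distr_orthogonal[OF that(2)] that(1)
    by simp
  show ?thesis
  proof (cases "integrable lebesgue f")
    case True
    then show ?thesis
      using integral_distr[of T lebesgue lebesgue f] lebesgue_distr_orthogonal[OF T] by simp
  next
    case False
    then have "\<not> integrable lebesgue (\<lambda>x. f (T x))"
      using *[of "\<lambda>x. f (T x)" S] S by auto
    with False show ?thesis by (simp add: not_integrable_integral_eq)
  qed
qed

lemma AE_lebesgue_orthogonal:
  fixes T :: "'a::euclidean_space \<Rightarrow> 'a"
  assumes T: "orthogonal_transformation T" and "AE x in lebesgue. P x"
  shows "AE x in lebesgue. P (T x)"
proof -
  have "AE x in distr lebesgue lebesgue T. P x"
    unfolding lebesgue_distr_orthogonal(2)[OF T] by (fact assms(2))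
  then show ?thesis by (rule AE_distrD[OF lebesgue_distr_orthogonal(1)[OF T]])
qed

text \<open>Lebesgue measure is complete, so measurability itself is invariant under equality a.e.,
  and two nonmeasurable functions both have integral 0. Integrands in \<open>\<Phi>\<close> can thus
  be rewritten a.e. directly.\<close>

lemma integral_lebesgue_cong_AE:
  fixes f g :: "'a::euclidean_space \<Rightarrow> real"
  assumes "AE x in lebesgue. f x = g x"
  shows "(LINT x|lebesgue. f x) = (LINT x|lebesgue. g x)"
proof (cases "f \<in> borel_measurable lebesgue")
  case True
  then show ?thesis
    using assms borel_measurable_AE by (blast intro: integral_cong_AE)
next
  case False
  moreover from this have "g \<notin> borel_measurable lebesgue"
    using assms by (metis (mono_tags, lifting) AE_cong borel_measurable_AE)
  ultimately show ?thesis
    using borel_measurable_integrable not_integrable_integral_eq by metis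
qed

section \<open>Weak Lebesgue norms: monotonicity, Chebyshev inequality, convergence a.e\<close>

lemma rearr_mono_AE:
  assumes [measurable]: "f \<in> borel_measurable M" "g \<in> borel_measurable M"
    and "AE x in M. \<bar>f x\<bar> \<le> \<bar>g x\<bar>"
  shows "rearr M f t \<le> rearr M g t"
  unfolding rearr_def
proof (rule Inf_superset_mono, safe)
  fix s :: real assume s: "s > 0" "emeasure M {x \<in> space M. \<bar>g x\<bar> > s} \<le> ennreal t"
  have "emeasure M {x \<in> space M. \<bar>f x\<bar> > s} \<le> emeasure M {x \<in> space M. \<bar>g x\<bar> > s}"
    using assms(3) by (intro emeasure_mono_AE) auto
  with s show "\<exists>s'. ennreal s = ennreal s' \<and> s' > 0 \<and> emeasure M {x \<in> space M. \<bar>f x\<bar> > s'} \<le> ennreal t"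
    by (intro exI[of _ s]) auto
qed

lemma weak_norm_mono_AE:
  assumes "f \<in> borel_measurable M" "g \<in> borel_measurable M"
    and "AE x in M. \<bar>f x\<bar> \<le> \<bar>g x\<bar>"
  shows "weak_norm r M f \<le> weak_norm r M g"
  unfolding weak_norm_def rearr_mean_def
  by (intro SUP_mono' mult_left_mono divide_right_mono_ennreal nn_integral_mono mult_right_mono
      rearr_mono_AE[OF assms]) auto

lemma weak_norm_zero: "weak_norm r M (\<lambda>x. 0) = 0"
proof -
  have "rearr M (\<lambda>x. 0) t = 0" for t
  proof -
    have "rearr M (\<lambda>x. 0) t \<le> ennreal e" if "e > 0" for e
      unfolding rearr_def using that by (intro Inf_lower) auto
    then show ?thesis
      by (metis ennreal_le_epsilon add_0 le_zero_eq order.refl)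
  qed
  then show ?thesis by (simp add: weak_norm_def rearr_mean_def)
qed

text \<open>If the level set at height \<open>s\<close> has measure above \<open>t\<close>, the
  rearrangement is at least \<open>s\<close> on all of (0,t), and so is its mean over (0,t).\<close>

lemma weak_norm_ge:
  assumes [measurable]: "f \<in> borel_measurable M"
    and s: "s > 0" and t: "t > 0" "ennreal t < emeasure M {x \<in> space M. \<bar>f x\<bar> > s}"
  shows "ennreal (t powr (1 / r) * s) \<le> weak_norm r M f"
proof -
  have rearr: "ennreal s \<le> rearr M f \<tau>" if "\<tau> \<in> {0<..<t}" for \<tau>
    unfolding rearr_def
  proof (rule Inf_greatest, clarify)
    fix s' assume s': "0 < s'" "emeasure M {x \<in> space M. \<bar>f x\<bar> > s'} \<le> ennreal \<tau>"
    show "ennreal s \<le> ennreal s'"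
    proof (rule ccontr)
      assume "\<not> ?thesis"
      then have "s' < s" using s by (meson ennreal_leI not_le)
      then have "emeasure M {x \<in> space M. \<bar>f x\<bar> > s} \<le> emeasure M {x \<in> space M. \<bar>f x\<bar> > s'}"
        by (intro emeasure_mono) auto
      also have "\<dots> \<le> ennreal t"
        using s'(2) that by (meson ennreal_leI greaterThanLessThan_iff less_imp_le order_trans)
      finally show False using t(2) by simp
    qed
  qed
  have "ennreal s * ennreal t = (\<integral>\<^sup>+ \<tau> \<in> {0<..<t}. ennreal s \<partial>lborel)"
    using t by (simp add: nn_integral_cmult_indicator)
  also have "\<dots> \<le> (\<integral>\<^sup>+ \<tau> \<in> {0<..<t}. rearr M f \<tau> \<partial>lborel)"
    using rearr by (intro nn_integral_mono) (auto simp: indicator_def)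
  finally have "ennreal s * ennreal t / ennreal t \<le> rearr_mean M f t"
    unfolding rearr_mean_def by (rule divide_right_mono_ennreal)
  then have "ennreal s \<le> rearr_mean M f t"
    using t by (simp add: ennreal_mult_divide_eq)
  then have "ennreal (t powr (1 / r) * s) \<le> ennreal (t powr (1 / r)) * rearr_mean M f t"
    using s by (simp add: ennreal_mult mult_left_mono)
  also have "\<dots> \<le> weak_norm r M f"
    unfolding weak_norm_def using t by (intro SUP_upper) auto
  finally show ?thesis .
qed

lemma weak_norm_Chebyshev:
  assumes f: "f \<in> borel_measurable M" and r: "r > 0" and s: "s > 0" and N: "N \<ge> 0"
    and le: "weak_norm r M f \<le> ennreal N"
  shows "emeasure M {x \<in> space M. \<bar>f x\<bar> > s} \<le> ennreal ((N / s) powr r)"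
proof (rule ccontr)
  assume "\<not> ?thesis"
  \<comment> \<open>Density of the order yields a finite \<open>t\<close> strictly between the
    claimed bound and the measure, even if the level set has infinite measure.\<close>
  then obtain a where a: "ennreal ((N / s) powr r) < a" "a < emeasure M {x \<in> space M. \<bar>f x\<bar> > s}"
    using dense[of "ennreal ((N / s) powr r)"] by (auto simp: not_le)
  then obtain t where t: "a = ennreal t" "t \<ge> 0"
    by (cases a) auto
  with a have less: "(N / s) powr r < t"
    by (simp add: ennreal_less_iff)
  then have t0: "t > 0" by (meson le_less_trans powr_ge_zero)
  have "ennreal (t powr (1 / r) * s) \<le> ennreal N"
    using weak_norm_ge[OF f s t0, of r] a t le by (meson order_trans)
  then have "t powr (1 / r) \<le> N / s"
    using N s by (simp add: ennreal_le_iff field_simps)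
  then have "(t powr (1 / r)) powr r \<le> (N / s) powr r"
    using r by (intro powr_mono2) auto
  with less t0 r show False by (simp add: powr_powr)
qed

text \<open>By Chebyshev the sets where \<open>f\<close> and \<open>g k\<close> differ by more than
  \<open>s\<close> have measures decaying like the powers of \<open>K powr r\<close>. These are
  summable, so Borel--Cantelli applies at each height \<open>s\<close>.\<close>

lemma AE_tendsto_of_weak_norm_geometric:
  assumes [measurable]: "f \<in> borel_measurable M" "\<And>k. g k \<in> borel_measurable M"
    and r: "r > 0" and K: "0 \<le> K" "K < 1" and N: "N \<ge> 0"
    and le: "\<And>k. weak_norm r M (\<lambda>x. f x - g k x) \<le> ennreal (K ^ k * N)"
  shows "AE x in M. (\<lambda>k. g k x) \<longlonglongrightarrow> f x"
proof -
  have ev: "AE x in M. eventually (\<lambda>k. x \<in> space M - {x \<in> space M. \<bar>f x - g k x\<bar> > s}) sequentially"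
    if s: "s > 0" for s :: real
  proof (rule borel_cantelli_AE1)
    have bound: "emeasure M {x \<in> space M. \<bar>f x - g k x\<bar> > s} \<le> ennreal ((N / s) powr r * (K powr r) ^ k)" for k
    proof -
      have "(K ^ k * N / s) powr r = (N / s) powr r * (K powr r) ^ k"
      \<comment> \<open>The law \<open>powr_realpow\<close> asks for a positive base; for
        \<open>K = 0\<close> both sides vanish unless \<open>k = 0\<close>, where both powers with
        exponent 0 equal 1.\<close>
      proof (cases "K = 0")
        case True
        then show ?thesis using r by (cases k) auto
      next
        case False
        with K N s have "(K ^ k * N / s) powr r = (N / s) powr r * (K ^ k) powr r"
          by (simp add: powr_mult[symmetric] mult.commute)
        also have "(K ^ k) powr r = (K powr r) ^ k"
          using False K by (simp add: powr_realpow[symmetric] powr_powr mult.commute)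
        finally show ?thesis .
      qed
      with weak_norm_Chebyshev[OF _ r s _ le[of k]] K N show ?thesis by simp
    qed
    show "emeasure M {x \<in> space M. \<bar>f x - g k x\<bar> > s} < \<infinity>" for k
      using le_less_trans[OF bound[of k] ennreal_less_top] by simp
    have "K powr r < 1"
      using powr_less_mono2[OF r K] by simp
    then have "summable (\<lambda>k. (N / s) powr r * (K powr r) ^ k)"
      by (intro summable_mult summable_geometric) auto
    moreover have "measure M {x \<in> space M. \<bar>f x - g k x\<bar> > s} \<le> (N / s) powr r * (K powr r) ^ k" for k
      unfolding measure_def using bound[of k] by (intro enn2real_leI) auto
    ultimately show "summable (\<lambda>k. measure M {x \<in> space M. \<bar>f x - g k x\<bar> > s})"
      by - (rule summable_comparison_test'[where N = 0], assumption, simp)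
  qed measurable
  \<comment> \<open>The countably many heights \<open>1 / Suc j\<close> suffice for convergence, and
    their exceptional null sets can be united.\<close>
  have "AE x in M. \<forall>j::nat. eventually (\<lambda>k. x \<in> space M - {x \<in> space M. \<bar>f x - g k x\<bar> > 1 / Suc j}) sequentially"
    unfolding AE_all_countable by (intro allI ev) simp
  then show ?thesis
  proof eventually_elim
    case (elim x)
    show ?case
      unfolding tendsto_iff
    proof safe
      fix e :: real assume "e > 0"
      then obtain j :: nat where j: "1 / Suc j < e" using nat_approx_posE by blast
      show "eventually (\<lambda>k. dist (g k x) (f x) < e) sequentially"
        using elim[rule_format, of j]
        by eventually_elim (use j in \<open>auto simp: dist_real_def\<close>)
    qed
  qed
qed

section \<open>Integrability of weak functions against Gaussian kernels\<close>

text \<open>Dyadic layers: \<open>|f| \<le> \<Sum>\<^sub>k 2\<^bsup>k+1\<^esup> 1\<^bsub>{|f| > 2\<^sup>k}\<^esub>\<close> where \<open>|f| > 1\<close>.\<close>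

lemma integrable_weak_L_large_part:
  assumes f: "f \<in> weak_L r M" and r: "r > 1"
  shows "integrable M (\<lambda>x. if \<bar>f x\<bar> > 1 then f x else 0)"
proof (rule integrableI_bounded)
  from f have fm[measurable]: "f \<in> borel_measurable M" and "weak_norm r M f < top"
    by (auto simp: weak_L_def)
  then obtain N where N: "N \<ge> 0" "weak_norm r M f = ennreal N"
    by (metis ennreal_cases less_irrefl)
  let ?A = "\<lambda>k::nat. {x \<in> space M. \<bar>f x\<bar> > 2 ^ k}"
  \<comment> \<open>Ratio of successive layer bounds: a factor 2 from the height, a factor
    \<open>2 powr (- r)\<close> from Chebyshev. It is below 1 because \<open>r > 1\<close>.\<close>
  let ?c = "2 powr (1 - r)"
  have layer: "ennreal (2 ^ Suc k) * emeasure M (?A k) \<le> ennreal (2 * N powr r * ?c ^ k)" for k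
  proof -
    have "(2::real) ^ k * (1 / 2 ^ k) powr r = ?c ^ k"
      by (simp add: powr_realpow[symmetric] powr_divide powr_powr powr_diff field_simps flip: powr_add)
    then have eq: "2 ^ Suc k * (N / 2 ^ k) powr r = 2 * N powr r * ?c ^ k"
      using N(1) powr_mult[of N "1 / 2 ^ k" r] by simp
    have "emeasure M (?A k) \<le> ennreal ((N / 2 ^ k) powr r)"
      using r N by (intro weak_norm_Chebyshev) auto
    then have "ennreal (2 ^ Suc k) * emeasure M (?A k) \<le> ennreal (2 ^ Suc k) * ennreal ((N / 2 ^ k) powr r)"
      by (rule mult_left_mono) simp
    also have "\<dots> = ennreal (2 * N powr r * ?c ^ k)"
      unfolding eq[symmetric] by (simp add: ennreal_mult)
    finally show ?thesis .
  qed
  have "ennreal (norm (if \<bar>f x\<bar> > 1 then f x else 0)) \<le> (\<Sum>k. ennreal (2 ^ Suc k) * indicator (?A k) x)"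
    if "x \<in> space M" for x
  proof (cases "\<bar>f x\<bar> > 1")
    case True
    obtain m where "\<bar>f x\<bar> \<le> 2 ^ m"
      using real_arch_pow[of 2 "\<bar>f x\<bar>"] by (auto intro: less_imp_le)
    \<comment> \<open>\<open>Suc k\<close> is the least exponent whose power of 2 dominates
      \<open>\<bar>f x\<bar>\<close>; it is not 0 because
      \<open>\<bar>f x\<bar> > 1\<close>.\<close>
    then obtain k where k: "\<bar>f x\<bar> \<le> 2 ^ Suc k" "\<bar>f x\<bar> > 2 ^ k"
      using ex_least_nat_less[of "\<lambda>m. \<bar>f x\<bar> \<le> 2 ^ m" m] True by (auto simp: not_le)
    have "ennreal (norm (if \<bar>f x\<bar> > 1 then f x else 0)) \<le> ennreal (2 ^ Suc k) * indicator (?A k) x"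
      using k that True by (auto intro!: ennreal_leI)
    also have "\<dots> \<le> (\<Sum>k. ennreal (2 ^ Suc k) * indicator (?A k) x)"
      using sum_le_suminf[of "\<lambda>k. ennreal (2 ^ Suc k) * indicator (?A k) x" "{k}"]
      by (simp del: sum_mult_indicator)
    finally show ?thesis .
  qed simp
  then have "(\<integral>\<^sup>+x. ennreal (norm (if \<bar>f x\<bar> > 1 then f x else 0)) \<partial>M)
      \<le> (\<integral>\<^sup>+x. (\<Sum>k. ennreal (2 ^ Suc k) * indicator (?A k) x) \<partial>M)"
    by (rule nn_integral_mono)
  also have "\<dots> = (\<Sum>k. ennreal (2 ^ Suc k) * emeasure M (?A k))"
    by (subst nn_integral_suminf) (auto simp: nn_integral_cmult_indicator simp del: power_Suc)
  also have "\<dots> \<le> (\<Sum>k. ennreal (2 * N powr r * ?c ^ k))"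
    by (intro suminf_le layer) auto
  also have "\<dots> < top"
  proof -
    have "?c < 1" using r by (simp add: powr_less_one)
    then have "summable (\<lambda>k. 2 * N powr r * ?c ^ k)"
      by (intro summable_mult summable_geometric) auto
    then show ?thesis by (simp add: suminf_ennreal2)
  qed
  finally show "(\<integral>\<^sup>+x. ennreal (norm (if \<bar>f x\<bar> > 1 then f x else 0)) \<partial>M) < \<infinity>" by simp
qed (use f in \<open>auto simp: weak_L_def\<close>)

text \<open>For \<open>r > 1\<close>, weak functions split into a bounded and an integrable part.
  The product is dominated by \<open>\<bar>g\<bar>\<close> where
  \<open>\<bar>f\<bar> \<le> 1\<close> and by \<open>C * \<bar>f\<bar>\<close> elsewhere.\<close>

lemma integrable_mult_weak_L:
  assumes f: "f \<in> weak_L r M" and r: "r > 1"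
    and g: "integrable M g" "\<And>x. \<bar>g x\<bar> \<le> C"
  shows "integrable M (\<lambda>x. g x * f x)"
proof (rule Bochner_Integration.integrable_bound)
  show "integrable M (\<lambda>x. \<bar>g x\<bar> + C * \<bar>if \<bar>f x\<bar> > 1 then f x else 0\<bar>)"
    using g integrable_weak_L_large_part[OF f r] by (intro Bochner_Integration.integrable_add integrable_mult_right integrable_abs)
  have [measurable]: "f \<in> borel_measurable M" "g \<in> borel_measurable M"
    using f g by (auto simp: weak_L_def)
  show "(\<lambda>x. g x * f x) \<in> borel_measurable M" by measurable
  have "\<bar>g x * f x\<bar> \<le> \<bar>g x\<bar> + C * \<bar>if \<bar>f x\<bar> > 1 then f x else 0\<bar>" for x
  proof (cases "\<bar>f x\<bar> > 1")
    case True
    then show ?thesis using mult_right_mono[OF g(2)[of x], of "\<bar>f x\<bar>"] by (simp add: abs_mult)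
  next
    case False
    then show ?thesis by (simp add: abs_mult mult_left_le)
  qed
  then show "AE x in M. norm (g x * f x) \<le> norm (\<bar>g x\<bar> + C * \<bar>if \<bar>f x\<bar> > 1 then f x else 0\<bar>)"
    by (intro AE_I2) (smt (verit) real_norm_def)
qed

text \<open>Expanding the norm in coordinates factors the Gaussian into one-dimensional ones, each a
  multiple of a normal density with variance \<open>2 * t\<close>.\<close>

lemma integrable_gaussian:
  fixes x :: "'a::euclidean_space"
  assumes t: "t > 0"
  shows "integrable lborel (\<lambda>y. exp (- (norm (x - y))\<^sup>2 / (4 * t)))"
proof (rule integrableI_bounded)
  let ?f = "\<lambda>b s. exp (- (x \<bullet> b - s)\<^sup>2 / (4 * t))"
  have fin: "(\<integral>\<^sup>+s. ennreal (?f b s) \<partial>lborel) < top" for b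
  proof -
    let ?c = "sqrt (2 * pi * (sqrt (2 * t))\<^sup>2)"
    have "?f b = (\<lambda>s. ?c * normal_density (x \<bullet> b) (sqrt (2 * t)) s)"
      using t by (intro ext) (simp add: normal_density_def power2_commute)
    then have "integrable lborel (?f b)"
      using integrable_normal_density[of "sqrt (2 * t)" "x \<bullet> b"] t by simp
    then show ?thesis by (simp add: integrable_iff_bounded)
  qed
  have "(norm (x - y))\<^sup>2 = (\<Sum>b\<in>Basis. (x \<bullet> b - y \<bullet> b)\<^sup>2)" for y
    unfolding power2_norm_eq_inner
    by (subst euclidean_inner) (simp add: power2_eq_square inner_diff_left)
  then have "ennreal (norm (exp (- (norm (x - y))\<^sup>2 / (4 * t)))) = (\<Prod>b\<in>Basis. ennreal (?f b (y \<bullet> b)))" for y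
    by (simp add: prod_ennreal exp_sum[symmetric] sum_negf sum_divide_distrib)
  then have "(\<integral>\<^sup>+y. ennreal (norm (exp (- (norm (x - y))\<^sup>2 / (4 * t)))) \<partial>lborel)
      = (\<Prod>b\<in>Basis. (\<integral>\<^sup>+s. ennreal (?f b s) \<partial>lborel))"
    using nn_integral_lborel_prod[of "\<lambda>b s. ennreal (?f b s)"] by simp
  also have "\<dots> < top"
    using fin by (simp add: less_top[symmetric] ennreal_prod_eq_top)
  finally show "(\<integral>\<^sup>+y. ennreal (norm (exp (- (norm (x - y))\<^sup>2 / (4 * t)))) \<partial>lborel) < \<infinity>" by simp
qed simp

section \<open>The half-space and its heat kernel with reflection\<close>

lemma half_space_lebesgue: "(half_space :: 'm::finite pt set) \<in> sets lebesgue"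
proof -
  have "open (half_space :: 'm::finite pt set)"
    unfolding half_space_def by (intro open_Collect_less continuous_intros)
  then show ?thesis by simp
qed

text \<open>Moves the reflection from \<open>y\<close> to \<open>x\<close>, so that the second term
  of \<open>G\<close> becomes a Gaussian in \<open>y\<close> centred at the reflected point.\<close>

lemma norm_reflection: "norm (x - (fst y, - snd y)) = norm ((fst x, - snd x) - y)"
  for x y :: "'m::finite pt"
proof -
  have "x - (fst y, - snd y) = (fst x - fst y, snd x + snd y)"
       "(fst x, - snd x) - y = (fst x - fst y, - (snd x + snd y))"
    by (auto simp: prod_eq_iff)
  then show ?thesis by (simp add: norm_Pair del: minus_add_distrib)
qed

lemma G_pos: "t > 0 \<Longrightarrow> G x y t > 0"
  by (simp add: G_def add_pos_pos)

lemma G_nonneg: "G x y t \<ge> 0"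
  by (simp add: G_def)

lemma G_le: "t > 0 \<Longrightarrow> G x y t \<le> (4 * pi * t) powr (- (real (CARD('m) + 1) / 2)) * 2"
  for x :: "'m::finite pt"
  unfolding G_def one_add_one[symmetric] by (intro mult_left_mono add_mono) auto

lemma integrable_G:
  assumes "t > 0"
  shows "integrable (lebesgue_on half_space) (\<lambda>y. G x y t)"
proof -
  have "integrable lborel (\<lambda>y. G x y t)"
    unfolding G_def norm_reflection
    using integrable_gaussian[OF assms, of x] integrable_gaussian[OF assms, of "(fst x, - snd x)"]
    by (intro integrable_mult_right Bochner_Integration.integrable_add)
  then have "integrable lebesgue (\<lambda>y. G x y t)"
    by (simp add: integrable_completion)
  then show ?thesis
    using integrable_mult_indicator[OF half_space_lebesgue, of "\<lambda>y. G x y t"]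
    by (simp add: integrable_restrict_space half_space_lebesgue)
qed

section \<open>Preservation of signs and strict positivity\<close>

text \<open>The conditions on \<open>h\<close> and \<open>V\<close> give the boundary source the
  sign of the trace of \<open>u\<close>, and the kernel is nonnegative; the second claim drops the
  boundary term. Nonintegrable integrands are harmless, since their integral 0 is nonnegative
  too.\<close>

lemma \<Phi>_nonneg:
  assumes h: "\<forall>a. 0 \<le> \<sigma> * a \<longrightarrow> 0 \<le> \<sigma> * h a"
    and u0: "AE x in lebesgue_on half_space. 0 \<le> \<sigma> * u0 x"
    and V: "AE x' in lebesgue. 0 \<le> V x'"
    and u: "\<forall>s>0. AE x' in lebesgue. 0 \<le> \<sigma> * bdry_trace (u s) x'"
  shows "\<sigma> * (LINT y | lebesgue_on half_space. G x y t * u0 y) \<ge> 0"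
    and "\<sigma> * \<Phi> u0 V h u t x \<ge> \<sigma> * (LINT y | lebesgue_on half_space. G x y t * u0 y)"
proof -
  have "0 \<le> (LINT y | lebesgue_on half_space. \<sigma> * (G x y t * u0 y))"
    by (rule integral_nonneg_AE, use u0 in eventually_elim)
      (metis G_nonneg mult.left_commute mult_nonneg_nonneg)
  then show "\<sigma> * (LINT y | lebesgue_on half_space. G x y t * u0 y) \<ge> 0" by simp
  have "0 \<le> (LINT s | lebesgue_on {0<..<t}. LINT y' | lebesgue.
        \<sigma> * (G x (y', 0) (t - s) * (h (bdry_trace (u s) y') + V y' * bdry_trace (u s) y')))"
  proof (rule Bochner_Integration.integral_nonneg, rule integral_nonneg_AE)
    fix s assume "s \<in> space (lebesgue_on {0<..<t})"
    then have "s > 0" by (simp add: space_restrict_space)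
    show "AE y' in lebesgue. 0 \<le>
        \<sigma> * (G x (y', 0) (t - s) * (h (bdry_trace (u s) y') + V y' * bdry_trace (u s) y'))"
      using V u[rule_format, OF \<open>s > 0\<close>]
    proof eventually_elim
      case (elim y')
      then have "0 \<le> G x (y', 0) (t - s) * (\<sigma> * h (bdry_trace (u s) y') + V y' * (\<sigma> * bdry_trace (u s) y'))"
        using h[rule_format, of "bdry_trace (u s) y'"] G_nonneg[of x "(y', 0)" "t - s"]
        by (metis add_nonneg_nonneg mult_nonneg_nonneg)
      then show ?case by (simp add: algebra_simps)
    qed
  qed
  moreover have "\<sigma> * a \<le> \<sigma> * (a + b)" if "0 \<le> \<sigma> * b" for a b :: real
    using that by (simp add: distrib_left)
  ultimately show "\<sigma> * \<Phi> u0 V h u t x \<ge> \<sigma> * (LINT y | lebesgue_on half_space. G x y t * u0 y)"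
    unfolding \<Phi>_def by simp
qed

text \<open>A nonnegative integrable function with integral 0 vanishes a.e., but
  \<open>G x y t * u0 y\<close> is nonzero for almost every \<open>y\<close> in the non-null set
  \<open>U\<close>. The boundary term can only increase the value in the direction of
  \<sigma>.\<close>

lemma \<Phi>_pos:
  assumes h: "\<forall>a. 0 \<le> \<sigma> * a \<longrightarrow> 0 \<le> \<sigma> * h a"
    and u0: "AE x in lebesgue_on half_space. 0 \<le> \<sigma> * u0 x"
    and V: "AE x' in lebesgue. 0 \<le> V x'"
    and u: "\<forall>s>0. AE x' in lebesgue. 0 \<le> \<sigma> * bdry_trace (u s) x'"
    and p: "p > 1" "u0 \<in> weak_L p (lebesgue_on half_space)"
    and U: "U \<subseteq> half_space" "U \<in> sets lebesgue" "emeasure lebesgue U > 0"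
    and u0U: "AE x in lebesgue_on U. 0 < \<sigma> * u0 x"
    and t: "t > 0"
  shows "0 < \<sigma> * \<Phi> u0 V h u t x"
proof -
  let ?I = "\<lambda>y. \<sigma> * (G x y t * u0 y)"
  \<comment> \<open>This excludes the default value 0 of the integral, which would destroy strict
    positivity.\<close>
  have "integrable (lebesgue_on half_space) (\<lambda>y. G x y t * u0 y)"
    using integrable_mult_weak_L[OF p(2,1) integrable_G[OF t], of x] G_le[OF t, of x] G_nonneg
    by (metis abs_of_nonneg)
  then have int: "integrable (lebesgue_on half_space) ?I" by simp
  have nn: "AE y in lebesgue_on half_space. 0 \<le> ?I y"
    using u0 by eventually_elim (metis G_nonneg mult.left_commute mult_nonneg_nonneg)
  have "integral\<^sup>L (lebesgue_on half_space) ?I \<noteq> 0"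
  proof
    assume "integral\<^sup>L (lebesgue_on half_space) ?I = 0"
    then have "AE y in lebesgue_on half_space. ?I y = 0"
      using integral_nonneg_eq_0_iff_AE[OF int nn] by simp
    then have "AE y in lebesgue. y \<in> half_space \<longrightarrow> ?I y = 0"
      by (subst (asm) AE_restrict_space_iff) (simp_all add: half_space_lebesgue)
    moreover have "AE y in lebesgue. y \<in> U \<longrightarrow> 0 < \<sigma> * u0 y"
      using u0U U(2) by (simp add: AE_restrict_space_iff)
    ultimately have "AE y in lebesgue. y \<notin> U"
    proof eventually_elim
      case (elim y)
      then show ?case using U(1) G_pos[OF t, of x y] by auto
    qed
    then have "emeasure lebesgue U = 0"
      using U(2) by (simp add: AE_iff_measurable[of U lebesgue "\<lambda>y. y \<notin> U"])
    with U(3) show False by simp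
  qed
  then have "\<sigma> * (LINT y | lebesgue_on half_space. G x y t * u0 y) \<noteq> 0" by simp
  then show ?thesis
    using \<Phi>_nonneg[OF h u0 V u, of x t] by linarith
qed

section \<open>Equivariance under rotations around the axis\<close>

lemma orthogonal_transformation_map_fst:
  fixes R :: "'a::euclidean_space \<Rightarrow> 'a"
  assumes R: "orthogonal_transformation R"
  shows "orthogonal_transformation (\<lambda>x. (R (fst x), snd x :: real))"
  using orthogonal_transformation_linear[OF R] R
  by (auto simp: orthogonal_transformation_def inner_prod_def linear_iff)

text \<open>The rotation leaves the last coordinate alone, so it commutes with the reflection and
  preserves both distances in the kernel.\<close>

lemma G_rotation:
  fixes R :: "real ^ 'm \<Rightarrow> real ^ 'm"
  assumes R: "orthogonal_transformation R"
  shows "G (R (fst x), snd x) (R (fst y), snd y) t = G x y t"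
proof -
  have "R a - R b = R (a - b)" for a b
    using orthogonal_transformation_linear[OF R] by (simp add: linear_diff)
  then have "norm (R a - R b) = norm (a - b)" for a b
    using orthogonal_transformation_norm[OF R] by simp
  then have "norm ((R (fst x), c) - (R (fst y), d)) = norm ((fst x, c) - (fst y, d))" for c d :: real
    by (simp add: norm_Pair)
  from this[of "snd x" "snd y"] this[of "snd x" "- snd y"] show ?thesis
    by (simp add: G_def)
qed

text \<open>Change of variables by the rotation in both integrals. The data are symmetric only a.e.,
  but the integrals erase null sets, so the conclusion holds at every point, in the same form as the
  hypothesis on \<open>u\<close>; this drives the induction over the iterates.\<close>

lemma \<Phi>_rotation:
  fixes R :: "real ^ 'm \<Rightarrow> real ^ 'm"
  assumes R: "orthogonal_transformation R"
    and h: "\<forall>a. h (\<sigma> * a) = \<sigma> * h a"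
    and V: "AE x' in lebesgue. V x' = V (R x')"
    and u0: "AE x in lebesgue_on half_space. u0 x = \<sigma> * u0 (R (fst x), snd x)"
    and u: "\<forall>s x. u s x = \<sigma> * u s (R (fst x), snd x)"
  shows "\<Phi> u0 V h u t x = \<sigma> * \<Phi> u0 V h u t (R (fst x), snd x)"
proof -
  let ?T = "\<lambda>x. (R (fst x), snd x :: real)"
  note T = orthogonal_transformation_map_fst[OF R]
  have "(LINT y | lebesgue_on half_space. G x y t * u0 y)
      = (LINT y | lebesgue. indicator half_space y * (G x y t * u0 y))"
    by (simp add: integral_restrict_space half_space_lebesgue)
  \<comment> \<open>Extended by the indicator, the integral lives on the whole space, where the
    change of variables is available; the rotation maps the half-space to itself.\<close>
  also have "\<dots> = (LINT y | lebesgue. \<sigma> * (indicator half_space (?T y) * (G (?T x) (?T y) t * u0 (?T y))))"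
  proof (rule integral_lebesgue_cong_AE)
    have "AE y in lebesgue. y \<in> half_space \<longrightarrow> u0 y = \<sigma> * u0 (?T y)"
      using u0 by (simp add: AE_restrict_space_iff half_space_lebesgue)
    then show "AE y in lebesgue. indicator half_space y * (G x y t * u0 y) =
        \<sigma> * (indicator half_space (?T y) * (G (?T x) (?T y) t * u0 (?T y)))"
    proof eventually_elim
      case (elim y)
      then show ?case
        using G_rotation[OF R, of x y t] by (auto simp: indicator_def half_space_def)
    qed
  qed
  also have "\<dots> = \<sigma> * (LINT y | lebesgue. indicator half_space y * (G (?T x) y t * u0 y))"
    using integral_lebesgue_orthogonal[OF T, of "\<lambda>y. indicator half_space y * (G (?T x) y t * u0 y)"]
    by simp
  also have "\<dots> = \<sigma> * (LINT y | lebesgue_on half_space. G (?T x) y t * u0 y)"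
    by (simp add: integral_restrict_space half_space_lebesgue)
  finally have 1: "(LINT y | lebesgue_on half_space. G x y t * u0 y)
      = \<sigma> * (LINT y | lebesgue_on half_space. G (?T x) y t * u0 y)" .
  let ?I = "\<lambda>x s y'. G x (y', 0) (t - s) * (h (bdry_trace (u s) y') + V y' * bdry_trace (u s) y')"
  have 2: "(LINT y' | lebesgue. ?I x s y') = \<sigma> * (LINT y' | lebesgue. ?I (?T x) s y')" for s
  proof -
    have "(LINT y' | lebesgue. ?I x s y') = (LINT y' | lebesgue. \<sigma> * ?I (?T x) s (R y'))"
    proof (rule integral_lebesgue_cong_AE, use V in eventually_elim)
      case (elim y')
      have "bdry_trace (u s) y' = \<sigma> * bdry_trace (u s) (R y')"
        using u[rule_format, of s "(y', 0)"] by (simp add: bdry_trace_def)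
      moreover have "G (?T x) (R y', 0) (t - s) = G x (y', 0) (t - s)"
        using G_rotation[OF R, of x "(y', 0)"] by simp
      ultimately show ?case using elim by (simp add: h algebra_simps)
    qed
    also have "\<dots> = \<sigma> * (LINT y' | lebesgue. ?I (?T x) s y')"
      using integral_lebesgue_orthogonal[OF R, of "?I (?T x) s"] by simp
    finally show ?thesis .
  qed
  show ?thesis
    unfolding \<Phi>_def 1 2 by (simp add: distrib_left)
qed

section \<open>Convergence of the Picard iterates\<close>

text \<open>Applied to functions that agree a.e., this lets the norm be computed with another
  representative.\<close>

lemma X_norm_mono_AE:
  assumes "f \<in> borel_measurable (lebesgue_on half_space)" "bdry_trace f \<in> borel_measurable lebesgue"
    and "g \<in> borel_measurable (lebesgue_on half_space)" "bdry_trace g \<in> borel_measurable lebesgue"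
    and "AE x in lebesgue_on half_space. \<bar>f x\<bar> \<le> \<bar>g x\<bar>"
    and "AE x' in lebesgue. \<bar>bdry_trace f x'\<bar> \<le> \<bar>bdry_trace g x'\<bar>"
  shows "X_norm p q f \<le> X_norm p q g"
  unfolding X_norm_def by (intro add_mono weak_norm_mono_AE assms)

lemma X_spaceD:
  assumes "f \<in> X_space p q"
  shows "f \<in> borel_measurable (lebesgue_on half_space)" "bdry_trace f \<in> borel_measurable lebesgue"
  using assms by (auto simp: X_space_def)

lemma bdry_trace_diff: "bdry_trace (\<lambda>x. f x - g x) = (\<lambda>x'. bdry_trace f x' - bdry_trace g x')"
  by (simp add: bdry_trace_def)

lemma E_ballD:
  assumes "u \<in> E_ball p q R" "t > 0"
  shows "u t \<in> X_space p q"
  using assms by (simp add: E_ball_def E_space_def)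

lemma zero_in_E_ball: "(\<lambda>t (x :: 'm::finite pt). 0) \<in> E_ball p q R"
proof -
  have "X_norm p q (\<lambda>x :: 'm pt. 0) = 0"
    by (simp add: X_norm_def bdry_trace_def weak_norm_zero)
  moreover have "E_norm p q (\<lambda>t (x :: 'm pt). 0) = 0"
    unfolding E_norm_def calculation by (rule SUP_const) auto
  ultimately show ?thesis
    by (simp add: E_ball_def E_space_def X_space_def bdry_trace_def)
qed

text \<open>Each application of \<open>F\<close> shrinks the distance to \<open>u\<close> by the
  factor \<open>K\<close>, so the \<open>k\<close>-th iterate is within \<open>K ^ k * N\<close> of
  \<open>u\<close>, where \<open>N\<close> is the norm of \<open>u\<close>. This bounds both
  components at each time, and geometric decay of weak norms gives convergence a.e.\<close>

lemma Picard_iterates_converge_AE: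
  assumes maps: "F ` B \<subseteq> B" and contr: "strict_contraction_on p q B F"
    and B: "B = E_ball p q R" and pq: "p > 0" "q > 0"
    and u: "u \<in> B" and fp: "\<forall>t>0. X_eq (F u t) (u t)"
    and t: "t > 0"
  shows "AE x in lebesgue_on half_space. (\<lambda>k. (F ^^ k) (\<lambda>t x. 0) t x) \<longlonglongrightarrow> u t x"
    and "AE x' in lebesgue. (\<lambda>k. bdry_trace ((F ^^ k) (\<lambda>t x. 0) t) x') \<longlonglongrightarrow> bdry_trace (u t) x'"
proof -
  let ?v = "\<lambda>k. (F ^^ k) (\<lambda>t x. 0)"
  have vB: "?v k \<in> B" for k
    using maps by (induction k) (auto simp: B zero_in_E_ball)
  have FB: "F w \<in> B" if "w \<in> B" for w using maps that by auto
  have meas: "w t \<in> borel_measurable (lebesgue_on half_space)" "bdry_trace (w t) \<in> borel_measurable lebesgue"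
    if "w \<in> B" "t > 0" for w t
    using E_ballD[of w p q R t] X_spaceD[of "w t"] that B by auto
  obtain K where K: "0 \<le> K" "K < 1" and
    contr': "\<And>u v. u \<in> B \<Longrightarrow> v \<in> B \<Longrightarrow>
      E_norm p q (\<lambda>t x. F u t x - F v t x) \<le> ennreal K * E_norm p q (\<lambda>t x. u t x - v t x)"
    using contr unfolding strict_contraction_on_def by auto
  obtain N where N: "N \<ge> 0" "E_norm p q u = ennreal N"
  proof (cases "E_norm p q u")
    case top
    with u B show thesis by (simp add: E_ball_def E_space_def)
  qed (rule that)
  have E: "E_norm p q (\<lambda>t x. u t x - ?v k t x) \<le> ennreal (K ^ k * N)" for k
  proof (induction k)
    case 0
    then show ?case by (simp add: N)
  next
    case (Suc k)
    \<comment> \<open>The fixed point equation holds only a.e. for each time, so \<open>u\<close> is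
      replaced by \<open>F u\<close> inside the norm.\<close>
    have "E_norm p q (\<lambda>t x. u t x - ?v (Suc k) t x) \<le> E_norm p q (\<lambda>t x. F u t x - F (?v k) t x)"
      unfolding E_norm_def
    proof (rule SUP_mono)
      fix t :: real assume "t \<in> {0<..}"
      then have t: "t > 0" by simp
      have "X_norm p q (\<lambda>x. u t x - ?v (Suc k) t x) \<le> X_norm p q (\<lambda>x. F u t x - F (?v k) t x)"
        using fp[rule_format, OF t] meas[OF u t] meas[OF FB[OF u] t] meas[OF FB[OF vB[of k]] t]
        by (intro X_norm_mono_AE) (auto simp: bdry_trace_diff X_eq_def elim: eventually_mono)
      then show "\<exists>t'\<in>{0<..}. X_norm p q (\<lambda>x. u t x - ?v (Suc k) t x) \<le> X_norm p q (\<lambda>x. F u t' x - F (?v k) t' x)"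
        using t by auto
    qed
    also have "\<dots> \<le> ennreal K * ennreal (K ^ k * N)"
      using contr'[OF u vB[of k]] Suc.IH by (meson mult_left_mono order_trans zero_le)
    also have "\<dots> = ennreal (K ^ Suc k * N)"
      using K N by (simp add: mult.assoc flip: ennreal_mult)
    finally show ?case .
  qed
  have X: "X_norm p q (\<lambda>x. u t x - ?v k t x) \<le> ennreal (K ^ k * N)" for k
    using E[of k] t unfolding E_norm_def by (meson SUP_le_iff greaterThan_iff)
  have W: "weak_norm p (lebesgue_on half_space) (\<lambda>x. u t x - ?v k t x) \<le> ennreal (K ^ k * N)"
    "weak_norm q lebesgue (\<lambda>x'. bdry_trace (u t) x' - bdry_trace (?v k t) x') \<le> ennreal (K ^ k * N)" for k
    by (rule order_trans[OF _ X[of k]], simp add: X_norm_def bdry_trace_diff)+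
  show "AE x in lebesgue_on half_space. (\<lambda>k. ?v k t x) \<longlonglongrightarrow> u t x"
    by (rule AE_tendsto_of_weak_norm_geometric[OF _ _ pq(1) K N(1) W(1)]) (rule meas u vB t)+
  show "AE x' in lebesgue. (\<lambda>k. bdry_trace (?v k t) x') \<longlonglongrightarrow> bdry_trace (u t) x'"
    by (rule AE_tendsto_of_weak_norm_geometric[OF _ _ pq(2) K N(1) W(2)]) (rule meas u vB t)+
qed

section \<open>Signs and symmetries of the fixed point\<close>

text \<open>The two signs \<open>\<sigma> = 1\<close> and \<open>\<sigma> = -1\<close> give the positive and negative case of (A), and the
  symmetric and antisymmetric case of (B).\<close>

lemma fixed_point_sign:
  assumes maps: "\<Phi> u0 V h ` E_ball p q R \<subseteq> E_ball p q R"
    and contr: "strict_contraction_on p q (E_ball p q R) (\<Phi> u0 V h)"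
    and pq: "p > 1" "q > 0" and u: "u \<in> E_ball p q R"
    and fp: "\<forall>t>0. X_eq (\<Phi> u0 V h u t) (u t)"
    and u0p: "u0 \<in> weak_L p (lebesgue_on half_space)"
    and U: "U \<subseteq> half_space" "U \<in> sets lebesgue" "emeasure lebesgue U > 0"
    and h: "\<forall>a. 0 \<le> \<sigma> * a \<longrightarrow> 0 \<le> \<sigma> * h a"
    and u0: "AE x in lebesgue_on half_space. 0 \<le> \<sigma> * u0 x"
    and u0U: "AE x in lebesgue_on U. 0 < \<sigma> * u0 x"
    and V: "AE x' in lebesgue. 0 \<le> V x'"
    and t: "t > 0"
  shows "AE x in lebesgue_on half_space. 0 < \<sigma> * u t x"
proof -
  \<comment> \<open>The sign of the iterates holds at every point, so it restricts to the boundary,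
    which is a null set of the ambient space.\<close>
  have iter: "0 \<le> \<sigma> * (\<Phi> u0 V h ^^ k) (\<lambda>t x. 0) t x" for k t x
  proof (induction k arbitrary: t x)
    case (Suc k)
    have "\<forall>s>0. AE x' in lebesgue. 0 \<le> \<sigma> * bdry_trace ((\<Phi> u0 V h ^^ k) (\<lambda>t x. 0) s) x'"
      using Suc by (simp add: bdry_trace_def)
    from \<Phi>_nonneg[OF h u0 V this, of x t] show ?case by simp
  qed simp
  have p: "p > 0" using pq(1) by simp
  \<comment> \<open>Weak inequalities survive the limit. The weak sign of the trace is what the
    boundary term needs; strictness comes from the data integral through
    \<open>u = \<Phi>(u)\<close>.\<close>
  have nonneg: "\<forall>s>0. AE x' in lebesgue. 0 \<le> \<sigma> * bdry_trace (u s) x'"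
  proof (intro allI impI)
    fix s :: real assume s: "s > 0"
    show "AE x' in lebesgue. 0 \<le> \<sigma> * bdry_trace (u s) x'"
      using Picard_iterates_converge_AE(2)[OF maps contr refl p pq(2) u fp s]
    proof eventually_elim
      case (elim x')
      show ?case
        by (rule LIMSEQ_le_const[OF tendsto_mult_left[OF elim]])
          (use iter in \<open>auto simp: bdry_trace_def\<close>)
    qed
  qed
  have "AE x in lebesgue_on half_space. \<Phi> u0 V h u t x = u t x"
    using fp[rule_format, OF t] by (simp add: X_eq_def)
  then show ?thesis
  proof eventually_elim
    case (elim x)
    then show ?case
      using \<Phi>_pos[OF h u0 V nonneg pq(1) u0p U u0U t, of x] by simp
  qed
qed

text \<open>The iterates have the symmetry at every point. As rotations preserve null sets, for
  almost every \<open>x\<close> the iterates converge both at \<open>x\<close> and at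
  \<open>T x\<close>, and uniqueness of limits transfers the identity to \<open>u\<close>.\<close>

lemma fixed_point_rotation:
  fixes R :: "real ^ 'm \<Rightarrow> real ^ 'm" and u0 :: "'m::finite pt \<Rightarrow> real"
  defines "T \<equiv> \<lambda>x. (R (fst x), snd x)"
  assumes maps: "\<Phi> u0 V h ` E_ball p q r \<subseteq> E_ball p q r"
    and contr: "strict_contraction_on p q (E_ball p q r) (\<Phi> u0 V h)"
    and pq: "p > 0" "q > 0" and u: "u \<in> E_ball p q r"
    and fp: "\<forall>t>0. X_eq (\<Phi> u0 V h u t) (u t)"
    and R: "orthogonal_transformation R"
    and h: "\<forall>a. h (\<sigma> * a) = \<sigma> * h a"
    and V: "AE x' in lebesgue. V x' = V (R x')"
    and u0: "AE x in lebesgue_on half_space. u0 x = \<sigma> * u0 (T x)"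
    and t: "t > 0"
  shows "AE x in lebesgue_on half_space. u t x = \<sigma> * u t (T x)"
    and "AE x' in lebesgue. bdry_trace (u t) x' = \<sigma> * bdry_trace (u t) (R x')"
proof -
  let ?v = "\<lambda>k. (\<Phi> u0 V h ^^ k) (\<lambda>t x. 0)"
  have T: "orthogonal_transformation T"
    unfolding T_def using orthogonal_transformation_map_fst[OF R] .
  have iter: "?v k t x = \<sigma> * ?v k t (T x)" for k t x
  proof (induction k arbitrary: t x)
    case (Suc k)
    have "\<forall>s x. ?v k s x = \<sigma> * ?v k s (R (fst x), snd x)"
      using Suc.IH unfolding T_def by blast
    from \<Phi>_rotation[OF R h V u0[unfolded T_def] this, of t x] show ?case
      by (simp add: T_def)
  qed simp
  note lim = Picard_iterates_converge_AE[OF maps contr refl pq u fp t]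
  have H: "AE x in lebesgue. x \<in> half_space \<longrightarrow> (\<lambda>k. ?v k t x) \<longlonglongrightarrow> u t x"
    using lim(1) by (simp add: AE_restrict_space_iff half_space_lebesgue)
  have "AE x in lebesgue. x \<in> half_space \<longrightarrow> u t x = \<sigma> * u t (T x)"
    using H AE_lebesgue_orthogonal[OF T H]
  proof eventually_elim
    case (elim x)
    show ?case
    proof
      assume x: "x \<in> half_space"
      then have "T x \<in> half_space" by (simp add: T_def half_space_def)
      then have "(\<lambda>k. ?v k t x) \<longlonglongrightarrow> \<sigma> * u t (T x)"
        unfolding iter[of _ t x] using elim by (intro tendsto_mult_left) auto
      with elim x show "u t x = \<sigma> * u t (T x)" using LIMSEQ_unique by blast
    qed
  qed
  then show "AE x in lebesgue_on half_space. u t x = \<sigma> * u t (T x)"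
    by (simp add: AE_restrict_space_iff half_space_lebesgue)
  show "AE x' in lebesgue. bdry_trace (u t) x' = \<sigma> * bdry_trace (u t) (R x')"
    using lim(2) AE_lebesgue_orthogonal[OF R lim(2)]
  proof eventually_elim
    case (elim x')
    have "bdry_trace (?v k t) x' = \<sigma> * bdry_trace (?v k t) (R x')" for k
      using iter[of k t "(x', 0)"] by (simp add: bdry_trace_def T_def)
    then have "(\<lambda>k. bdry_trace (?v k t) x') \<longlonglongrightarrow> \<sigma> * bdry_trace (u t) (R x')"
      using tendsto_mult_left[OF elim(2), of \<sigma>] by simp
    with elim(1) show ?case using LIMSEQ_unique by blast
  qed
qed

theorem theorem3p4:
  fixes n :: nat
    and \<rho> \<eta> p q \<delta>1 \<delta>2 :: real
    and \<epsilon> h :: "real \<Rightarrow> real"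
    and V :: "real ^ 'm \<Rightarrow> real"
    and u0 :: "(real ^ 'm) \<times> real \<Rightarrow> real"
    and u :: "real \<Rightarrow> (real ^ 'm) \<times> real \<Rightarrow> real"
    and U :: "((real ^ 'm) \<times> real) set"
    and A :: "((real ^ 'm) \<times> real \<Rightarrow> (real ^ 'm) \<times> real) set"
  assumes dim: "n = CARD('m) + 1" "n \<ge> 3"
    and rho: "\<rho> > 1" "\<rho> / (\<rho> - 1) < real n - 1"
    and exponents: "p = real n * (\<rho> - 1)" "q = (real n - 1) * (\<rho> - 1)"
    and h: "\<eta> > 0" "growth_cond \<rho> \<eta> h"
    and constants: "admissible_constants TYPE('m) \<rho> \<eta> p q \<delta>1 \<delta>2 \<epsilon>"
    and V: "V \<in> weak_L (real n - 1) lebesgue"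
    and u0: "u0 \<in> weak_L p (lebesgue_on half_space)"
    and small: "small_data p \<delta>1 \<delta>2 \<epsilon> u0 V"
    and u: "mild_solution p q \<delta>1 \<epsilon> u0 V h u"
    and U: "U \<subseteq> half_space" "U \<in> sets lebesgue" "emeasure lebesgue U > 0"
    and A: "A \<subseteq> axis_rotations"
  shows
    "((\<forall>a\<ge>0. h a \<ge> 0) \<and>
      (AE x in lebesgue_on half_space. u0 x \<ge> 0) \<and>
      (AE x in lebesgue_on U. u0 x > 0) \<and>
      (AE x' in lebesgue. V x' \<ge> 0)
      \<longrightarrow> (\<forall>t>0. AE x in lebesgue_on half_space. u t x > 0))
   \<and> ((\<forall>a\<le>0. h a \<le> 0) \<and>
      (AE x in lebesgue_on half_space. u0 x \<le> 0) \<and>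
      (AE x in lebesgue_on U. u0 x < 0) \<and>
      (AE x' in lebesgue. V x' \<ge> 0)
      \<longrightarrow> (\<forall>t>0. AE x in lebesgue_on half_space. u t x < 0))
   \<and> ((\<forall>a. h a = - h (- a)) \<and>
      symmetric_under lebesgue (boundary_restrictions A) V \<and>
      symmetric_under (lebesgue_on half_space) A u0
      \<longrightarrow> (\<forall>t>0. symmetric_under (lebesgue_on half_space) A (u t) \<and>
                  symmetric_under lebesgue (boundary_restrictions A) (bdry_trace (u t))))
   \<and> ((\<forall>a. h a = - h (- a)) \<and>
      symmetric_under lebesgue (boundary_restrictions A) V \<and>
      antisymmetric_under (lebesgue_on half_space) A u0
      \<longrightarrow> (\<forall>t>0. antisymmetric_under (lebesgue_on half_space) A (u t) \<and>
                  antisymmetric_under lebesgue (boundary_restrictions A) (bdry_trace (u t))))"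
proof -
  \<comment> \<open>Multiplied by \<open>\<rho> - 1\<close>, the condition on \<rho> reads
    \<open>\<rho> < q\<close>. As \<open>p\<close> exceeds \<open>q\<close> by
    \<open>\<rho> - 1\<close>, this gives \<open>p > 1\<close>, the range in which the kernel can be
    integrated against \<open>u0\<close>.\<close>
  have "\<rho> < q" "0 < \<rho> - 1"
    using rho exponents by (auto simp: field_simps)
  moreover have "p = q + (\<rho> - 1)" unfolding exponents by (simp add: algebra_simps)
  ultimately have pq: "p > 1" "q > 0" "p > 0" using rho by linarith+
  define R where "R = 2 * \<epsilon> (gamma_of \<delta>1 V) / (1 - gamma_of \<delta>1 V)"
  have ball: "solution_ball p q \<delta>1 \<epsilon> V = E_ball p q R"
    by (simp add: solution_ball_def R_def)
  have "V \<in> weak_L (real CARD('m)) lebesgue" using V dim by simp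
  then have maps: "\<Phi> u0 V h ` E_ball p q R \<subseteq> E_ball p q R"
    and contr: "strict_contraction_on p q (E_ball p q R) (\<Phi> u0 V h)"
    using constants[unfolded admissible_constants_def, THEN conjunct2, THEN conjunct2, THEN conjunct2,
        rule_format, of h V u0] h(2) u0 small
    by (simp_all add: ball)
  have uB: "u \<in> E_ball p q R" and fp: "\<forall>t>0. X_eq (\<Phi> u0 V h u t) (u t)"
    using u by (auto simp: mild_solution_def ball)
  note sign = fixed_point_sign[OF maps contr pq(1,2) uB fp u0 U]
  note rot = fixed_point_rotation[OF maps contr pq(3,2) uB fp]
  have rotations: "\<exists>R. orthogonal_transformation R \<and> T = (\<lambda>x. (R (fst x), snd x))" if "T \<in> A" for T
    using A that by (auto simp: axis_rotations_def)
  have sym: "(AE x in lebesgue_on half_space. u t x = \<sigma> * u t (T x)) \<and>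
      (AE x' in lebesgue. bdry_trace (u t) x' = \<sigma> * bdry_trace (u t) (fst (T (x', 0))))"
    if asm: "\<sigma> = 1 \<or> \<sigma> = - 1" "\<forall>a. h a = - h (- a)" "T \<in> A" "t > 0"
      "AE x' in lebesgue. V x' = V (fst (T (x', 0)))"
      "AE x in lebesgue_on half_space. u0 x = \<sigma> * u0 (T x)" for \<sigma> T t
  proof -
    obtain R where R: "orthogonal_transformation R" "T = (\<lambda>x. (R (fst x), snd x))"
      using rotations[OF asm(3)] by blast
    \<comment> \<open>For \<open>\<sigma> = 1\<close> this is trivial, for
      \<open>\<sigma> = - 1\<close> it is oddness of \<open>h\<close>.\<close>
    have "\<forall>a. h (\<sigma> * a) = \<sigma> * h a"
      using asm(1) asm(2) by (metis minus_minus mult_1 mult_minus1)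
    from rot[OF R(1) this _ _ asm(4)] asm(5,6) show ?thesis
      unfolding R(2) by simp
  qed
  show ?thesis
  proof (intro conjI impI allI; (elim conjE)?)
    fix t :: real
    assume "\<forall>a\<ge>0. h a \<ge> 0" "AE x in lebesgue_on half_space. u0 x \<ge> 0"
      "AE x in lebesgue_on U. u0 x > 0" "AE x' in lebesgue. V x' \<ge> 0" "t > 0"
    then show "AE x in lebesgue_on half_space. u t x > 0"
      using sign[of 1 t] by simp
  next
    fix t :: real
    assume "\<forall>a\<le>0. h a \<le> 0" "AE x in lebesgue_on half_space. u0 x \<le> 0"
      "AE x in lebesgue_on U. u0 x < 0" "AE x' in lebesgue. V x' \<ge> 0" "t > 0"
    then show "AE x in lebesgue_on half_space. u t x < 0"
      using sign[of "-1" t] by simp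
  next
    fix t :: real
    assume h_odd: "\<forall>a. h a = - h (- a)" and t: "t > 0"
      and V: "symmetric_under lebesgue (boundary_restrictions A) V"
      and u0: "symmetric_under (lebesgue_on half_space) A u0"
    have "(AE x in lebesgue_on half_space. u t x = u t (T x)) \<and>
      (AE x' in lebesgue. bdry_trace (u t) x' = bdry_trace (u t) (fst (T (x', 0))))" if "T \<in> A" for T
      using sym[of "1" T t, OF _ h_odd that t] V u0 that
      by (simp add: symmetric_under_def antisymmetric_under_def boundary_restrictions_def)
    then show "symmetric_under (lebesgue_on half_space) A (u t)"
      "symmetric_under lebesgue (boundary_restrictions A) (bdry_trace (u t))"
      by (simp_all add: symmetric_under_def boundary_restrictions_def)
  next
    fix t :: real
    assume h_odd: "\<forall>a. h a = - h (- a)" and t: "t > 0"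
      and V: "symmetric_under lebesgue (boundary_restrictions A) V"
      and u0: "antisymmetric_under (lebesgue_on half_space) A u0"
    have "(AE x in lebesgue_on half_space. u t x = - u t (T x)) \<and>
      (AE x' in lebesgue. bdry_trace (u t) x' = - bdry_trace (u t) (fst (T (x', 0))))" if "T \<in> A" for T
      using sym[of "-1" T t, OF _ h_odd that t] V u0 that
      by (simp add: symmetric_under_def antisymmetric_under_def boundary_restrictions_def)
    then show "antisymmetric_under (lebesgue_on half_space) A (u t)"
      "antisymmetric_under lebesgue (boundary_restrictions A) (bdry_trace (u t))"
      by (simp_all add: antisymmetric_under_def boundary_restrictions_def)
  qed
qed

end
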